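(* For integers $m,k\ge0$ and $n\ge m+k$, and every nonnegative integer $r$, \[ \binom{m+k}{m}S_{2,\lambda}^{(r,Y)}(n+r,m+k+r)=\sum_{l=m}^{n-k}\binom{n}{l}S_{2,\lambda}^{(r,Y)}(l+r,m+r)\,S_{2,\lambda}^{Y}(n-l,k). \]
   Context: Let $\lambda$ be a nonzero real number. Define $(x)_{0,\lambda}=1$ and $(x)_{n,\lambda}=x(x-\lambda)\cdots(x-(n-1)\lambda)$ for $n\ge1$, and the degenerate exponential $e_{\lambda}^{x}(t)=(1+\lambda t)^{x/\lambda}=\sum_{n\ge0}(x)_{n,\lambda}\frac{t^n}{n!}$. Let $Y$ be a random variable whose moment generating function exists in a neighborhood of the origin, let $(Y_j)_{j\ge1}$ be mutually independent copies of $Y$, and set $S_0=0$, $S_k=Y_1+\cdots+Y_k$ for $k\ge1$. The probabilistic degenerate Stirling numbers of the second kind associated with $Y$ are defined by $\frac{1}{k!}\big(E[e_{\lambda}^{Y}(t)]-1\big)^{k}=\sum_{n=k}^{\infty}S_{2,\lambda}^{Y}(n,k)\frac{t^n}{n!}$. For $r$ a nonnegative integer, the probabilistic degenerate $r$-Stirling numbers of the second kind associated with $Y$ are defined by \[ \frac{1}{k!}\Big(E\big[e_{\lambda}^{Y}(t)\big]-1\Big)^{k}E\big[e_{\lambda}^{S_r}(t)\big]=\sum_{n=k}^{\infty}S_{2,\lambda}^{(r,Y)}(n+r,k+r)\frac{t^n}{n!},\quad(k\ge0). \] *)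

theory Defs
  imports "HOL-Probability.Probability"
begin

definition degenerate_falling :: "real \<Rightarrow> real \<Rightarrow> nat \<Rightarrow> real" where
  "degenerate_falling lam x n = (\<Prod>i<n. x - real i * lam)"

text \<open>The power is meaningful where \<open>1 + lam * t > 0\<close>; below only \<open>t\<close> near \<open>0\<close> matters.\<close>

definition degenerate_exp :: "real \<Rightarrow> real \<Rightarrow> real \<Rightarrow> real" where
  "degenerate_exp lam x t = (1 + lam * t) powr (x / lam)"

lemma degenerate_exp_sums:
  assumes "lam \<noteq> 0" and "\<bar>lam * t\<bar> < 1"
  shows "(\<lambda>n. degenerate_falling lam x n * t ^ n / fact n) sums degenerate_exp lam x t"
proof -
  have "degenerate_falling lam x n * t ^ n / fact n = ((x / lam) gchoose n) * (lam * t) ^ n" for n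
  proof -
    have "((x / lam) gchoose n) * lam ^ n = (\<Prod>i<n. (x / lam - real i) * lam) / fact n"
      by (simp add: gbinomial_prod_rev prod.distrib atLeast0LessThan)
    also have "\<dots> = degenerate_falling lam x n / fact n"
      using assms(1) by (simp add: degenerate_falling_def left_diff_distrib)
    finally show ?thesis
      by (metis (no_types, lifting) mult.assoc power_mult_distrib times_divide_eq_left)
  qed
  then show ?thesis
    using gen_binomial_real[OF assms(2), of "x / lam"] by (simp add: degenerate_exp_def)
qed

definition mgf_exists_near_0 :: "'a measure \<Rightarrow> ('a \<Rightarrow> real) \<Rightarrow> bool" where
  "mgf_exists_near_0 M Y \<longleftrightarrow>
     (\<exists>d>0. \<forall>t. \<bar>t\<bar> < d \<longrightarrow> integrable M (\<lambda>\<omega>. exp (t * Y \<omega>)))"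

definition independent_copies :: "'a measure \<Rightarrow> ('a \<Rightarrow> real) \<Rightarrow> (nat \<Rightarrow> 'a \<Rightarrow> real) \<Rightarrow> bool" where
  "independent_copies M Y Yc \<longleftrightarrow>
     prob_space.indep_vars M (\<lambda>_. borel) Yc {1..} \<and>
     (\<forall>j\<ge>1. distr M borel (Yc j) = distr M borel Y)"

definition copies_sum :: "(nat \<Rightarrow> 'a \<Rightarrow> real) \<Rightarrow> nat \<Rightarrow> 'a \<Rightarrow> real" where
  "copies_sum Yc k \<omega> = (\<Sum>j=1..k. Yc j \<omega>)"

text \<open>
  \<open>egf_coeff k f\<close> is the sequence \<open>a\<close> with \<open>f t = (\<Sum>n\<ge>k. a n * t ^ n / n!)\<close> for all
  \<open>t\<close> in a neighbourhood of \<open>0\<close>, extended by \<open>0\<close> to the indices below \<open>k\<close>.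
  It is unspecified if \<open>f\<close> has no such expansion.
\<close>

definition egf_coeff :: "nat \<Rightarrow> (real \<Rightarrow> real) \<Rightarrow> nat \<Rightarrow> real" where
  "egf_coeff k f =
     (THE a. (\<forall>n<k. a n = 0) \<and> f has_fps_expansion Abs_fps (\<lambda>n. a n / fact n))"

lemma eval_fps_eqD_real:
  fixes F G :: "real fps"
  assumes "fps_conv_radius F > 0" "fps_conv_radius G > 0"
    and "\<forall>\<^sub>F z in nhds 0. eval_fps F z = eval_fps G z"
  shows "F = G"
proof (rule fps_ext)
  fix n show "fps_nth F n = fps_nth G n"
    using assms
  proof (induction n arbitrary: F G)
    case 0
    then show ?case using eventually_nhds_x_imp_x[OF 0(3)] by (simp add: eval_fps_at_0)
  next
    case (Suc n)
    have "\<forall>\<^sub>F z in nhds 0. \<forall>\<^sub>F w in nhds z. eval_fps F w = eval_fps G w"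
      using Suc.prems(3) by (simp add: eventually_eventually)
    moreover have "\<forall>\<^sub>F z in nhds 0. z \<in> eball 0 (fps_conv_radius F)"
      "\<forall>\<^sub>F z in nhds 0. z \<in> eball 0 (fps_conv_radius G)"
      using Suc.prems(1,2) by (intro eventually_nhds_in_open; simp add: zero_ereal_def)+
    ultimately have "\<forall>\<^sub>F z in nhds 0. eval_fps (fps_deriv F) z = eval_fps (fps_deriv G) z"
    proof eventually_elim
      case (elim z)
      then show ?case
        by (simp add: eval_fps_deriv deriv_cong_ev)
    qed
    then have "fps_nth (fps_deriv F) n = fps_nth (fps_deriv G) n"
      using Suc.prems(1,2) fps_conv_radius_deriv[of F] fps_conv_radius_deriv[of G]
      by (intro Suc.IH) (auto intro: less_le_trans)
    then show ?case by simp
  qed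
qed

lemma egf_coeff_eqI:
  assumes "\<And>n. n < k \<Longrightarrow> a n = 0" and "f has_fps_expansion Abs_fps (\<lambda>n. a n / fact n)"
  shows "egf_coeff k f = a"
  unfolding egf_coeff_def
proof (rule the_equality)
  fix b assume "(\<forall>n<k. b n = 0) \<and> f has_fps_expansion Abs_fps (\<lambda>n. b n / fact n)"
  then have b: "f has_fps_expansion Abs_fps (\<lambda>n. b n / fact n)" ..
  let ?A = "Abs_fps (\<lambda>n. a n / fact n)" and ?B = "Abs_fps (\<lambda>n. b n / fact n)"
  have "\<forall>\<^sub>F z in nhds 0. eval_fps ?B z = eval_fps ?A z"
    using b assms(2) by (auto simp: has_fps_expansion_def elim: eventually_elim2)
  then have "?B = ?A"
    using b assms(2) by (intro eval_fps_eqD_real) (auto simp: has_fps_expansion_def)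
  then show "b = a"
    by (auto simp: fps_eq_iff)
qed (use assms in auto)

definition prob_degenerate_Stirling2 ::
    "'a measure \<Rightarrow> real \<Rightarrow> ('a \<Rightarrow> real) \<Rightarrow> nat \<Rightarrow> nat \<Rightarrow> real" where
  "prob_degenerate_Stirling2 M lam Y n k =
     egf_coeff k
       (\<lambda>t. 1 / fact k * ((\<integral>\<omega>. degenerate_exp lam (Y \<omega>) t \<partial>M) - 1) ^ k) n"

text \<open>
  As in the usual notation for \<open>r\<close>-Stirling numbers, the last two arguments are the shifted
  indices \<open>N = n + r\<close> and \<open>K = k + r\<close>; only \<open>N \<ge> r\<close> and \<open>K \<ge> r\<close> are meaningful.
\<close>

definition prob_degenerate_r_Stirling2 ::
    "'a measure \<Rightarrow> real \<Rightarrow> ('a \<Rightarrow> real) \<Rightarrow> (nat \<Rightarrow> 'a \<Rightarrow> real) \<Rightarrow> nat \<Rightarrow> nat \<Rightarrow> nat \<Rightarrow> real" where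
  "prob_degenerate_r_Stirling2 M lam Y Yc r N K =
     (let n = N - r; k = K - r in
      egf_coeff k
        (\<lambda>t. 1 / fact k * ((\<integral>\<omega>. degenerate_exp lam (Y \<omega>) t \<partial>M) - 1) ^ k
               * (\<integral>\<omega>. degenerate_exp lam (copies_sum Yc r \<omega>) t \<partial>M)) n)"

end

theory Submission
  imports Defs
begin

unbundle no vec_syntax and fps_syntax

text \<open>
  Put \<open>f t = E[e_lam^Y(t)]\<close>. Two analytic facts are needed: \<open>f\<close> has a power series expansion
  \<open>F\<close> at \<open>0\<close> with \<open>F 0 = 1\<close>, by integrating the binomial series termwise, and
  \<open>E[e_lam^(S_r)(t)] = f t ^ r\<close> near \<open>0\<close>, by independence. With
  \<open>G m = (F - 1)^m * F^r / m!\<close> and \<open>H k = (F - 1)^k / k!\<close> the claim is then the comparison of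
  coefficients in \<open>G m * H k = (m + k choose m) * G (m + k)\<close>, where the terms of the
  convolution outside \<open>m \<le> l \<le> n - k\<close> vanish because \<open>F - 1\<close> has no constant term.
\<close>

text \<open>The bound makes the base \<open>1 + lam * t\<close> positive, so \<open>powr\<close>
  unfolds to \<open>exp\<close>. Expectations of \<open>degenerate_exp\<close> thus become values of
  the moment generating function at \<open>ln (1 + lam * t) / lam\<close>, which tends to 0 with
  \<open>t\<close>.\<close>

lemma degenerate_exp_eq_exp:
  assumes "\<bar>lam * t\<bar> < 1"
  shows "degenerate_exp lam x t = exp (ln (1 + lam * t) / lam * x)"
  using assms by (auto simp: degenerate_exp_def powr_def abs_if split: if_splits)

lemma degenerate_falling_0: "degenerate_falling lam x 0 = 1"
  by (simp add: degenerate_falling_def)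

lemma degenerate_falling_measurable [measurable]:
  "(\<lambda>x. degenerate_falling lam x n) \<in> borel_measurable borel"
  unfolding degenerate_falling_def by measurable

lemma degenerate_exp_measurable [measurable]:
  "(\<lambda>x. degenerate_exp lam x t) \<in> borel_measurable borel"
  unfolding degenerate_exp_def by measurable

text \<open>Triangle inequality in each factor. The majorant is again a degenerate falling
  factorial, with parameter \<open>- \<bar>lam\<bar>\<close>, so the dominating series sums to a
  degenerate exponential.\<close>

lemma degenerate_falling_abs_le:
  "\<bar>degenerate_falling lam x n\<bar> \<le> degenerate_falling (- \<bar>lam\<bar>) \<bar>x\<bar> n"
  unfolding degenerate_falling_def abs_prod
proof (intro prod_mono conjI)
  fix i
  have "\<bar>x - real i * lam\<bar> \<le> \<bar>x\<bar> + \<bar>real i * lam\<bar>"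
    by (rule abs_triangle_ineq4)
  then show "\<bar>x - real i * lam\<bar> \<le> \<bar>x\<bar> - real i * - \<bar>lam\<bar>"
    by (simp add: abs_mult)
qed simp

text \<open>Depending on the sign of \<open>Y \<omega>\<close>, the integrand is one of the two
  given exponentials, hence at most their sum.\<close>

lemma integrable_exp_abs:
  fixes Y :: "'a \<Rightarrow> real"
  assumes [measurable]: "Y \<in> borel_measurable M"
    and "integrable M (\<lambda>\<omega>. exp (s * Y \<omega>))" "integrable M (\<lambda>\<omega>. exp (- s * Y \<omega>))"
  shows "integrable M (\<lambda>\<omega>. exp (s * \<bar>Y \<omega>\<bar>))"
proof (rule Bochner_Integration.integrable_bound)
  show "integrable M (\<lambda>\<omega>. exp (s * Y \<omega>) + exp (- s * Y \<omega>))"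
    using assms by simp
  have "exp (s * \<bar>y\<bar>) \<le> exp (s * y) + exp (- s * y)" for y :: real
    by (cases "y \<ge> 0") auto
  then show "AE \<omega> in M. norm (exp (s * \<bar>Y \<omega>\<bar>)) \<le> norm (exp (s * Y \<omega>) + exp (- s * Y \<omega>))"
    by (intro AE_I2) (simp add: abs_of_pos add_pos_pos)
qed measurable

text \<open>Filter form for a moving argument \<open>g t\<close>; both signs are recorded to feed
  \<open>integrable_exp_abs\<close>.\<close>

lemma mgf_exists_near_0D:
  assumes "mgf_exists_near_0 M Y" "(g \<longlongrightarrow> 0) F"
  shows "\<forall>\<^sub>F t in F. integrable M (\<lambda>\<omega>. exp (g t * Y \<omega>)) \<and> integrable M (\<lambda>\<omega>. exp (- g t * Y \<omega>))"
proof -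
  obtain d where "d > 0" and d: "\<And>t. \<bar>t\<bar> < d \<Longrightarrow> integrable M (\<lambda>\<omega>. exp (t * Y \<omega>))"
    using assms(1) unfolding mgf_exists_near_0_def by blast
  then have "\<forall>\<^sub>F t in F. \<bar>g t\<bar> < d"
    using tendstoD[OF assms(2), of d] by simp
  then show ?thesis
    proof eventually_elim
    case (elim t)
    then show ?case
      using d[of "g t"] d[of "- g t"] by simp
  qed
qed

lemma tendsto_lam_mult_0: "((\<lambda>t. lam * t) \<longlongrightarrow> 0) (nhds (0::real))"
  by (auto intro!: tendsto_eq_intros filterlim_ident)

lemma tendsto_ln_1_plus_divide:
  fixes u :: "'a \<Rightarrow> real"
  assumes "(u \<longlongrightarrow> 0) F"
  shows "((\<lambda>x. ln (1 + u x) / c) \<longlongrightarrow> 0) F"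
proof -
  have "((\<lambda>x. ln (1 + u x)) \<longlongrightarrow> ln (1 + 0)) F"
    by (intro tendsto_intros assms) auto
  from tendsto_mult_left_zero[of _ _ "inverse c", OF this[simplified]] show ?thesis
    by (simp add: divide_inverse)
qed

lemma eventually_abs_lam_mult_less_1: "\<forall>\<^sub>F t in nhds (0::real). \<bar>lam * t\<bar> < 1"
  using tendstoD[OF tendsto_lam_mult_0, of 1] by simp

lemma eventually_integrable_degenerate_exp:
  assumes "mgf_exists_near_0 M Y"
  shows "\<forall>\<^sub>F t in nhds 0. integrable M (\<lambda>\<omega>. degenerate_exp lam (Y \<omega>) t)"
proof -
  have "((\<lambda>t. ln (1 + lam * t) / lam) \<longlongrightarrow> 0) (nhds 0)"
    by (rule tendsto_ln_1_plus_divide[OF tendsto_lam_mult_0])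
  from mgf_exists_near_0D[OF assms this] eventually_abs_lam_mult_less_1[of lam]
  show ?thesis
    by eventually_elim (simp add: degenerate_exp_eq_exp)
qed

text \<open>Supplies the integrable majorant for integrating the binomial series termwise. The
  function is \<open>exp (s * \<bar>Y \<omega>\<bar>)\<close> with \<open>s\<close> tending to 0 as
  \<open>t\<close> does.\<close>

lemma eventually_integrable_degenerate_exp_abs:
  assumes "mgf_exists_near_0 M Y" and "Y \<in> borel_measurable M"
  shows "\<forall>\<^sub>F t in nhds 0. integrable M (\<lambda>\<omega>. degenerate_exp (- \<bar>lam\<bar>) \<bar>Y \<omega>\<bar> \<bar>t\<bar>)"
proof -
  have *: "((\<lambda>t. - \<bar>lam\<bar> * \<bar>t\<bar>) \<longlongrightarrow> 0) (nhds 0)"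
    by (auto intro!: tendsto_eq_intros filterlim_ident)
  have "((\<lambda>t. ln (1 + - \<bar>lam\<bar> * \<bar>t\<bar>) / - \<bar>lam\<bar>) \<longlongrightarrow> 0) (nhds 0)"
    by (rule tendsto_ln_1_plus_divide[OF *])
  from mgf_exists_near_0D[OF assms(1) this] eventually_abs_lam_mult_less_1[of lam]
  show ?thesis
  proof eventually_elim
    case (elim t)
    have "\<bar>- \<bar>lam\<bar> * \<bar>t\<bar>\<bar> < 1"
      using elim(2) by (simp add: abs_mult)
    then have eq: "degenerate_exp (- \<bar>lam\<bar>) x \<bar>t\<bar> = exp (ln (1 + - \<bar>lam\<bar> * \<bar>t\<bar>) / - \<bar>lam\<bar> * x)" for x
      by (rule degenerate_exp_eq_exp)
    show ?case
      unfolding eq using elim(1) assms(2) by (intro integrable_exp_abs) auto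
  qed
qed

lemma expectation_degenerate_exp_has_fps_expansion:
  assumes "lam \<noteq> 0" and [measurable]: "Y \<in> borel_measurable M" and "mgf_exists_near_0 M Y"
  shows "(\<lambda>t. \<integral>\<omega>. degenerate_exp lam (Y \<omega>) t \<partial>M) has_fps_expansion
    Abs_fps (\<lambda>n. (\<integral>\<omega>. degenerate_falling lam (Y \<omega>) n \<partial>M) / fact n)"
proof (rule has_fps_expansionI)
  show "\<forall>\<^sub>F t in nhds 0. (\<lambda>n. Abs_fps (\<lambda>n. (\<integral>\<omega>. degenerate_falling lam (Y \<omega>) n \<partial>M) / fact n) $ n * t ^ n)
    sums (\<integral>\<omega>. degenerate_exp lam (Y \<omega>) t \<partial>M)"
    using eventually_integrable_degenerate_exp_abs[OF assms(3,2), of lam]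
      eventually_abs_lam_mult_less_1[of lam]
  proof eventually_elim
    case (elim t)
    \<comment> \<open>\<open>D\<close> is the sum of the nonnegative series \<open>b\<close>, which
      majorises \<open>a\<close> term by term; it therefore bounds all partial sums of absolute
      values at once.\<close>
    define D where "D \<omega> = degenerate_exp (- \<bar>lam\<bar>) \<bar>Y \<omega>\<bar> \<bar>t\<bar>" for \<omega>
    define a where "a n \<omega> = degenerate_falling lam (Y \<omega>) n * t ^ n / fact n" for n \<omega>
    define b where "b n \<omega> = degenerate_falling (- \<bar>lam\<bar>) \<bar>Y \<omega>\<bar> n * \<bar>t\<bar> ^ n / fact n" for n \<omega>
    have [measurable]: "a n \<in> borel_measurable M" for n
      unfolding a_def by measurable
    have D: "integrable M D"
      unfolding D_def by (rule elim(1))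
    have b: "(\<lambda>n. b n \<omega>) sums D \<omega>" for \<omega>
      unfolding b_def D_def using elim(2) assms(1)
      by (intro degenerate_exp_sums) (auto simp: abs_mult)
    have ab: "\<bar>a n \<omega>\<bar> \<le> b n \<omega>" for n \<omega>
      unfolding a_def b_def
      by (auto simp: abs_mult power_abs intro!: divide_right_mono mult_right_mono degenerate_falling_abs_le)
    have b_nonneg: "0 \<le> b n \<omega>" for n \<omega>
      using ab[of n \<omega>] by linarith
    have bD: "(\<Sum>n<N. b n \<omega>) \<le> D \<omega>" for N \<omega>
      using b[of \<omega>] b_nonneg by (metis sums_iff sum_le_suminf finite_lessThan)
    have partial: "(\<Sum>n<N. \<bar>a n \<omega>\<bar>) \<le> D \<omega>" for N \<omega>
      by (rule order_trans[OF sum_mono bD]) (rule ab)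
    have single: "\<bar>a n \<omega>\<bar> \<le> D \<omega>" for n \<omega>
    proof -
      have "\<bar>a n \<omega>\<bar> \<le> (\<Sum>i<Suc n. \<bar>a i \<omega>\<bar>)"
        by (intro member_le_sum) auto
      then show ?thesis
        using partial[where N = "Suc n" and \<omega> = \<omega>] by linarith
    qed
    have int: "integrable M (a n)" for n
      by (rule Bochner_Integration.integrable_bound[OF D])
        (auto intro!: AE_I2 order_trans[OF single abs_ge_self])
    have "(\<lambda>n. \<integral>\<omega>. a n \<omega> \<partial>M) sums (\<integral>\<omega>. (\<Sum>n. a n \<omega>) \<partial>M)"
    proof (rule sums_integral[OF int])
      show "AE \<omega> in M. summable (\<lambda>n. norm (a n \<omega>))"
        by (intro AE_I2 summableI_nonneg_bounded[where x = "D _"]) (use partial in auto)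
      \<comment> \<open>The bound is uniform in \<open>N\<close>, which makes the series of L1 norms
        converge and so permits exchanging sum and integral.\<close>
      have "(\<Sum>n<N. \<integral>\<omega>. \<bar>a n \<omega>\<bar> \<partial>M) \<le> (\<integral>\<omega>. D \<omega> \<partial>M)" for N
      proof -
        have "(\<Sum>n<N. \<integral>\<omega>. \<bar>a n \<omega>\<bar> \<partial>M) = (\<integral>\<omega>. (\<Sum>n<N. \<bar>a n \<omega>\<bar>) \<partial>M)"
          using int by (subst Bochner_Integration.integral_sum) auto
        also have "\<dots> \<le> (\<integral>\<omega>. D \<omega> \<partial>M)"
          using int D partial by (intro integral_mono) auto
        finally show ?thesis .
      qed
      then show "summable (\<lambda>n. \<integral>\<omega>. norm (a n \<omega>) \<partial>M)"
        by (intro summableI_nonneg_bounded[where x = "\<integral>\<omega>. D \<omega> \<partial>M"]) auto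
    qed
    moreover have "(\<integral>\<omega>. a n \<omega> \<partial>M) = (\<integral>\<omega>. degenerate_falling lam (Y \<omega>) n \<partial>M) / fact n * t ^ n" for n
      by (simp add: a_def)
    moreover have "(\<Sum>n. a n \<omega>) = degenerate_exp lam (Y \<omega>) t" for \<omega>
      using degenerate_exp_sums[OF assms(1) elim(2)] by (simp add: a_def sums_iff)
    ultimately show ?case
      by simp
  qed
qed

text \<open>The functional equation of \<open>exp\<close>. For infinite \<open>I\<close> the sum
  defaults to 0 and the product to 1, which agree.\<close>

lemma degenerate_exp_sum:
  assumes "\<bar>lam * t\<bar> < 1"
  shows "degenerate_exp lam (sum x I) t = (\<Prod>i\<in>I. degenerate_exp lam (x i) t)"
proof (cases "finite I")
  case True
  then show ?thesis
    using assms by (simp add: degenerate_exp_eq_exp sum_distrib_left exp_sum)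
qed (use assms in \<open>simp add: degenerate_exp_eq_exp\<close>)

lemma (in prob_space) expectation_degenerate_exp_copies_sum:
  assumes [measurable]: "Y \<in> borel_measurable M" and copies: "independent_copies M Y Yc"
    and "\<bar>lam * t\<bar> < 1" and int: "integrable M (\<lambda>\<omega>. degenerate_exp lam (Y \<omega>) t)"
  shows "expectation (\<lambda>\<omega>. degenerate_exp lam (copies_sum Yc r \<omega>) t) =
    expectation (\<lambda>\<omega>. degenerate_exp lam (Y \<omega>) t) ^ r"
proof -
  have indep: "indep_vars (\<lambda>_. borel) Yc {1..}"
    and distr: "\<And>j. j \<ge> 1 \<Longrightarrow> distr M borel (Yc j) = distr M borel Y"
    using copies unfolding independent_copies_def by auto
  have meas: "Yc j \<in> borel_measurable M" if "j \<in> {1..r}" for j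
    using indep that unfolding indep_vars_def by auto
  \<comment> \<open>Integrability depends only on the law, so it passes from \<open>Y\<close> to
    each copy through the common push-forward measure.\<close>
  have int': "integrable M (\<lambda>\<omega>. degenerate_exp lam (Yc j \<omega>) t)" if "j \<in> {1..r}" for j
  proof -
    have "integrable (distr M borel (Yc j)) (\<lambda>x. degenerate_exp lam x t)"
      using that int by (simp add: distr integrable_distr_eq)
    then show ?thesis
      using meas[OF that] by (simp add: integrable_distr_eq)
  qed
  have exp': "expectation (\<lambda>\<omega>. degenerate_exp lam (Yc j \<omega>) t) =
      expectation (\<lambda>\<omega>. degenerate_exp lam (Y \<omega>) t)" if "j \<in> {1..r}" for j
    using that meas[OF that] distr[of j]
      integral_distr[of "Yc j" M borel "\<lambda>x. degenerate_exp lam x t"]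
      integral_distr[of Y M borel "\<lambda>x. degenerate_exp lam x t"] by simp
  \<comment> \<open>Borel functions of independent variables are independent, so the expectation of
    the product factors.\<close>
  have "indep_vars (\<lambda>_. borel) (\<lambda>j \<omega>. degenerate_exp lam (Yc j \<omega>) t) {1..r}"
    by (rule indep_vars_compose2[OF indep_vars_subset[OF indep]]) auto
  then have "expectation (\<lambda>\<omega>. \<Prod>j=1..r. degenerate_exp lam (Yc j \<omega>) t) =
      (\<Prod>j=1..r. expectation (\<lambda>\<omega>. degenerate_exp lam (Yc j \<omega>) t))"
    using int' by (intro indep_vars_lebesgue_integral) auto
  also have "\<dots> = (\<Prod>j=1..r. expectation (\<lambda>\<omega>. degenerate_exp lam (Y \<omega>) t))"
    by (rule prod.cong[OF refl exp'])
  finally show ?thesis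
    using assms(3) by (simp add: copies_sum_def degenerate_exp_sum)
qed

lemma has_fps_expansion_power:
  fixes f :: "'a :: {banach, real_normed_field} \<Rightarrow> 'a"
  assumes "f has_fps_expansion F"
  shows "(\<lambda>x. f x ^ n) has_fps_expansion F ^ n"
  by (induction n) (auto intro: has_fps_expansion_mult assms)

text \<open>An expansion depends only on the germ at 0; this lets \<open>f t ^ r\<close> replace the
  expectation over \<open>copies_sum\<close>, an identity valid only near 0.\<close>

lemma has_fps_expansion_cong_ev:
  assumes "f has_fps_expansion F" "\<forall>\<^sub>F x in nhds 0. g x = f x"
  shows "g has_fps_expansion F"
  using assms unfolding has_fps_expansion_def by (auto elim: eventually_elim2)

lemma egf_coeff_eq_fps_nth:
  assumes "f has_fps_expansion F" "\<And>n. n < k \<Longrightarrow> F $ n = 0"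
  shows "egf_coeff k f n = fact n * F $ n"
proof -
  have "egf_coeff k f = (\<lambda>n. fact n * F $ n)"
    by (rule egf_coeff_eqI) (use assms in \<open>auto simp: fps_nth_inverse\<close>)
  then show ?thesis by simp
qed

text \<open>A series without constant term is divisible by X, so its \<open>k\<close>-th power is
  divisible by X to the power \<open>k\<close>.\<close>

lemma fps_mult_power_nth_eq_0:
  fixes A :: "'a::comm_ring_1 fps"
  assumes "A $ 0 = 0" "n < k"
  shows "(A ^ k * B) $ n = 0"
  using startsby_zero_power_prefix[OF assms(1), of k] assms(2) by (simp add: fps_mult_nth)

theorem theorem2p8:
  fixes M :: "'a measure" and lam :: real
    and Y :: "'a \<Rightarrow> real" and Yc :: "nat \<Rightarrow> 'a \<Rightarrow> real"
    and m k n r :: nat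
  assumes "prob_space M"
    and "lam \<noteq> 0"
    and "Y \<in> borel_measurable M"
    and "mgf_exists_near_0 M Y"
    and "independent_copies M Y Yc"
    and "n \<ge> m + k"
  shows "real ((m + k) choose m) * prob_degenerate_r_Stirling2 M lam Y Yc r (n + r) (m + k + r)
    = (\<Sum>l=m..n-k. real (n choose l) * prob_degenerate_r_Stirling2 M lam Y Yc r (l + r) (m + r)
                    * prob_degenerate_Stirling2 M lam Y (n - l) k)"
proof -
  interpret prob_space M by fact
  define f where "f t = expectation (\<lambda>\<omega>. degenerate_exp lam (Y \<omega>) t)" for t
  define F where "F = Abs_fps (\<lambda>n. expectation (\<lambda>\<omega>. degenerate_falling lam (Y \<omega>) n) / fact n)"
  define A where "A = F - 1"
  \<comment> \<open>One family serves both kinds of numbers: \<open>s = r\<close> gives the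
    r-Stirling numbers and \<open>s = 0\<close> the ordinary ones.\<close>
  define G where "G j s = fps_const (1 / fact j) * (A ^ j * F ^ s)" for j s
  have f: "f has_fps_expansion F"
    unfolding f_def F_def by (rule expectation_degenerate_exp_has_fps_expansion) fact+
  \<comment> \<open>The constant term of \<open>F\<close> is the expectation of the constant 1,
    which is 1 for a probability measure.\<close>
  have A0: "A $ 0 = 0"
    by (simp add: A_def F_def degenerate_falling_0 prob_space)
  have G_eq_0: "G j s $ i = 0" if "i < j" for i j s
    using fps_mult_power_nth_eq_0[OF A0 that] by (simp add: G_def)
  have G: "(\<lambda>t. 1 / fact j * (f t - 1) ^ j * f t ^ s) has_fps_expansion G j s" for j s
  proof -
    have "(\<lambda>t. 1 / fact j * (f t - 1) ^ j * f t ^ s) has_fps_expansion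
        fps_const (1 / fact j) * A ^ j * F ^ s"
      unfolding A_def
      by (intro has_fps_expansion_mult has_fps_expansion_cmult_left has_fps_expansion_power
          has_fps_expansion_diff has_fps_expansion_1 f)
    then show ?thesis
      by (simp add: G_def mult_ac)
  qed
  have ev: "\<forall>\<^sub>F t in nhds 0. expectation (\<lambda>\<omega>. degenerate_exp lam (copies_sum Yc r \<omega>) t) = f t ^ r"
    using eventually_integrable_degenerate_exp[OF assms(4), of lam] eventually_abs_lam_mult_less_1[of lam]
    unfolding f_def
    by eventually_elim (intro expectation_degenerate_exp_copies_sum assms)
  have S: "prob_degenerate_Stirling2 M lam Y i j = fact i * G j 0 $ i" for i j
    unfolding prob_degenerate_Stirling2_def f_def[symmetric]
    using G[of j 0] G_eq_0 by (intro egf_coeff_eq_fps_nth) auto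
  have Sr: "prob_degenerate_r_Stirling2 M lam Y Yc r (i + r) (j + r) = fact i * G j r $ i" for i j
    unfolding prob_degenerate_r_Stirling2_def f_def[symmetric] Let_def add_diff_cancel_right'
  proof (rule egf_coeff_eq_fps_nth[OF _ G_eq_0])
    show "(\<lambda>t. 1 / fact j * (f t - 1) ^ j * expectation (\<lambda>\<omega>. degenerate_exp lam (copies_sum Yc r \<omega>) t))
      has_fps_expansion G j r"
      by (rule has_fps_expansion_cong_ev[OF G]) (use ev in eventually_elim, simp)
  qed
  have "G m r * G k 0 = (fps_const (1 / fact m) * fps_const (1 / fact k)) * (A ^ (m + k) * F ^ r)"
    by (simp only: G_def power_add power_0 mult_1_left mult_1_right mult_ac)
  also have "fps_const (1 / fact m) * fps_const (1 / fact k) =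
      fps_const (real ((m + k) choose m)) * fps_const (1 / fact (m + k))"
    by (simp add: binomial_fact)
  finally have conv: "G m r * G k 0 = fps_const (real ((m + k) choose m)) * G (m + k) r"
    by (simp only: G_def mult.assoc)
  have "real ((m + k) choose m) * prob_degenerate_r_Stirling2 M lam Y Yc r (n + r) (m + k + r) =
      fact n * (G m r * G k 0) $ n"
    by (simp add: Sr[of n "m + k", simplified] conv)
  also have "\<dots> = fact n * (\<Sum>l=0..n. G m r $ l * G k 0 $ (n - l))"
    by (simp add: fps_mult_nth)
  also have "(\<Sum>l=0..n. G m r $ l * G k 0 $ (n - l)) = (\<Sum>l=m..n-k. G m r $ l * G k 0 $ (n - l))"
    \<comment> \<open>For \<open>l < m\<close> the first factor vanishes; for
      \<open>l > n - k\<close> the index \<open>n - l\<close> is below \<open>k\<close> and the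
      second one does.\<close>
    by (rule sum.mono_neutral_right) (auto simp: not_le intro!: G_eq_0)
  also have "fact n * \<dots> = (\<Sum>l=m..n-k. real (n choose l) * (fact l * G m r $ l) * (fact (n - l) * G k 0 $ (n - l)))"
    unfolding sum_distrib_left
  proof (rule sum.cong[OF refl])
    \<comment> \<open>Passing to exponential coefficients: \<open>fact n\<close> splits as
      \<open>n choose l\<close> times \<open>fact l * fact (n - l)\<close>, which requires
      \<open>l \<le> n\<close>.\<close>
    fix l assume "l \<in> {m..n-k}"
    then have "l \<le> n"
      by auto
    then show "fact n * (G m r $ l * G k 0 $ (n - l)) =
        real (n choose l) * (fact l * G m r $ l) * (fact (n - l) * G k 0 $ (n - l))"
      by (simp add: binomial_fact)
  qed
  finally show ?thesis
    by (simp add: S Sr)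
qed

end
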